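(* Let $m\ge2$ and $n\ge3$ be integers. Then the cone of positive semidefinite matrices in $\mathcal{Q}(m)\otimes\mathcal{S}(n)$ is strictly larger than the cone of PPT matrices in $\mathcal{Q}(m)\otimes\mathcal{S}(n)$.
   Context: $\mathcal{S}(n)$ is the real vector space of real symmetric $n\times n$ matrices. $\mathcal{Q}(N)$ is the real vector space of quaternionic hermitian $N\times N$ matrices ($A=A^*$, with $*$ the quaternionic conjugate transpose); $A\in\mathcal{Q}(N)$ is positive semidefinite (PSD) if $v^*Av\ge0$ for all $v\in\mathbb{H}^N$. The (real) tensor product $\mathcal{Q}(m)\otimes\mathcal{S}(n)$ is regarded as a subspace of $\mathcal{Q}(mn)$ via the Kronecker product ($m\times m$ blocks of size $n\times n$, $A\otimes B=(a_{\alpha\beta}B)$). The partial transpose $A^\Gamma$ of an $mn\times mn$ matrix $A$ partitioned into $m\times m$ blocks $A_{\alpha\beta}$ of size $n\times n$ is obtained by exchanging the blocks $A_{\alpha\beta}$ and $A_{\beta\alpha}$ for all $\alpha\ne\beta$. A hermitian matrix $A$ is a PPT matrix if both $A$ and $A^\Gamma$ are PSD. *)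

theory Defs
  imports "HOL-Analysis.Analysis"
begin

text \<open>The skew field of quaternions; \<open>Quat a b c d\<close> stands for \<open>a + b i + c j + d k\<close>.\<close>

datatype quat = Quat (qre: real) (qi: real) (qj: real) (qk: real)

lemma quat_eq_iff: "x = y \<longleftrightarrow> qre x = qre y \<and> qi x = qi y \<and> qj x = qj y \<and> qk x = qk y"
  by (cases x; cases y) simp

instantiation quat :: ring_1
begin

definition zero_quat :: quat where "zero_quat = Quat 0 0 0 0"

definition one_quat :: quat where "one_quat = Quat 1 0 0 0"

definition plus_quat :: "quat \<Rightarrow> quat \<Rightarrow> quat" where
  "plus_quat x y = Quat (qre x + qre y) (qi x + qi y) (qj x + qj y) (qk x + qk y)"

definition uminus_quat :: "quat \<Rightarrow> quat" where
  "uminus_quat x = Quat (- qre x) (- qi x) (- qj x) (- qk x)"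

definition minus_quat :: "quat \<Rightarrow> quat \<Rightarrow> quat" where
  "minus_quat x y = Quat (qre x - qre y) (qi x - qi y) (qj x - qj y) (qk x - qk y)"

definition times_quat :: "quat \<Rightarrow> quat \<Rightarrow> quat" where
  "times_quat x y = Quat
     (qre x * qre y - qi x * qi y - qj x * qj y - qk x * qk y)
     (qre x * qi y + qi x * qre y + qj x * qk y - qk x * qj y)
     (qre x * qj y - qi x * qk y + qj x * qre y + qk x * qi y)
     (qre x * qk y + qi x * qj y - qj x * qi y + qk x * qre y)"

instance
  by standard
    (simp_all add: quat_eq_iff zero_quat_def one_quat_def plus_quat_def uminus_quat_def
      minus_quat_def times_quat_def algebra_simps)

end

instantiation quat :: real_algebra_1
begin

definition scaleR_quat :: "real \<Rightarrow> quat \<Rightarrow> quat" where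
  "scaleR_quat r x = Quat (r * qre x) (r * qi x) (r * qj x) (r * qk x)"

instance
  by standard
    (simp_all add: quat_eq_iff scaleR_quat_def plus_quat_def times_quat_def algebra_simps)

end

lemma quat_units:
  "Quat 0 1 0 0 * Quat 0 1 0 0 = - 1"
  "Quat 0 0 1 0 * Quat 0 0 1 0 = - 1"
  "Quat 0 0 0 1 * Quat 0 0 0 1 = - 1"
  "Quat 0 1 0 0 * Quat 0 0 1 0 = Quat 0 0 0 1"
  "Quat 0 0 1 0 * Quat 0 0 0 1 = Quat 0 1 0 0"
  "Quat 0 0 0 1 * Quat 0 1 0 0 = Quat 0 0 1 0"
  by (simp_all add: times_quat_def uminus_quat_def one_quat_def)

definition qcnj :: "quat \<Rightarrow> quat" where
  "qcnj x = Quat (qre x) (- qi x) (- qj x) (- qk x)"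

definition qadjoint :: "quat^'k^'l \<Rightarrow> quat^'l^'k" where
  "qadjoint A = (\<chi> i j. qcnj (A $ j $ i))"

text \<open>The spaces \<open>Q(N)\<close> and \<open>S(n)\<close>, with \<open>N = CARD('k)\<close> and \<open>n = CARD('n)\<close>.\<close>

definition quat_hermitian :: "(quat^'k^'k) set" where
  "quat_hermitian = {A. qadjoint A = A}"

definition real_symmetric :: "(real^'n^'n) set" where
  "real_symmetric = {B. transpose B = B}"

text \<open>The value \<open>v\<^sup>* A v\<close>; the order of the factors matters.\<close>

definition qform :: "quat^'k^'k \<Rightarrow> quat^'k \<Rightarrow> quat" where
  "qform A v = (\<Sum>i\<in>UNIV. \<Sum>j\<in>UNIV. qcnj (v $ i) * A $ i $ j * v $ j)"

text \<open>A quaternion is \<open>\<ge> 0\<close> if it is a nonnegative real number.\<close>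

definition quat_psd :: "quat^'k^'k \<Rightarrow> bool" where
  "quat_psd A \<longleftrightarrow> A \<in> quat_hermitian \<and> (\<forall>v. qform A v \<in> \<real>\<^sub>\<ge>\<^sub>0)"

text \<open>
  An \<open>mn \<times> mn\<close> matrix that is partitioned into \<open>m \<times> m\<close> blocks of size \<open>n \<times> n\<close> has its
  rows and columns indexed by the type \<open>'m \<times> 'n\<close>, where \<open>m = CARD('m)\<close> and \<open>n = CARD('n)\<close>.
  The first component selects the block, the second one the position inside the block.
\<close>

definition kronecker ::
  "quat^'m::finite^'m \<Rightarrow> real^'n::finite^'n \<Rightarrow> quat^('m \<times> 'n)^('m \<times> 'n)" where
  "kronecker A B = (\<chi> p q. A $ fst p $ fst q * of_real (B $ snd p $ snd q))"

definition tensor_QS :: "(quat^('m::finite \<times> 'n::finite)^('m \<times> 'n)) set" where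
  "tensor_QS = span {kronecker A B | A B. A \<in> quat_hermitian \<and> B \<in> real_symmetric}"

text \<open>Block \<open>(\<alpha>, \<beta>)\<close> of the partial transpose is the (untransposed) block \<open>(\<beta>, \<alpha>)\<close> of \<open>A\<close>.\<close>

definition partial_transpose ::
  "quat^('m::finite \<times> 'n::finite)^('m \<times> 'n) \<Rightarrow> quat^('m \<times> 'n)^('m \<times> 'n)" where
  "partial_transpose A = (\<chi> p q. A $ (fst q, snd p) $ (fst p, snd q))"

definition quat_ppt :: "quat^('m::finite \<times> 'n::finite)^('m \<times> 'n) \<Rightarrow> bool" where
  "quat_ppt A \<longleftrightarrow> A \<in> quat_hermitian \<and> quat_psd A \<and> quat_psd (partial_transpose A)"

lemma subspace_quat_hermitian: "subspace (quat_hermitian :: (quat^'k^'k) set)"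
  by (auto simp: subspace_def quat_hermitian_def qadjoint_def vec_eq_iff qcnj_def quat_eq_iff
      zero_quat_def plus_quat_def scaleR_quat_def simp flip: mult_minus_right)

lemma kronecker_hermitian:
  assumes "A \<in> quat_hermitian" "B \<in> real_symmetric"
  shows "kronecker A B \<in> quat_hermitian"
proof -
  have A: "qcnj (A $ j $ i) = A $ i $ j" for i j
    using assms(1) by (auto simp: quat_hermitian_def qadjoint_def vec_eq_iff)
  have B: "B $ j $ i = B $ i $ j" for i j
    using assms(2) by (auto simp: real_symmetric_def transpose_def vec_eq_iff)
  have c: "qcnj (x * of_real r) = qcnj x * of_real r" for x r
    by (simp add: of_real_def qcnj_def times_quat_def scaleR_quat_def one_quat_def)
  show ?thesis
    unfolding quat_hermitian_def qadjoint_def kronecker_def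
    by (simp add: vec_eq_iff c A B)
qed

lemma tensor_QS_hermitian: "tensor_QS \<subseteq> quat_hermitian"
  unfolding tensor_QS_def
  by (rule span_minimal) (auto intro: kronecker_hermitian simp: subspace_quat_hermitian)

end

(* For m = 2, n = 3 consider [[1, Z], [Z*, Y]] with Y real symmetric and Z quaternionic with
   Z^T = Z.  It is PSD iff Y >= Z* Z, and its partial transpose is PSD iff Y >= Z Z*.
   Let W = [[1, k, j], [k, 0, i], [j, i, -1]], let Z be the entrywise conjugate of W,
   which equals W*, and put Y = diag (6, 2, 6).  Then Y - W W* = 3 w w* with w = (1, 0, -j)^T,
   whereas Y - W* W has a zero at position (2,2) but the nonzero entry -2k at position (1,2).
   Padding with zeros gives all larger m and n. *)

theory Submission
  imports Defs
begin

text \<open>The entry type is left open so that the same units serve both the quaternionic and the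
  real tensor factor.\<close>

definition mat_unit :: "'k \<Rightarrow> 'l \<Rightarrow> 'a::zero \<Rightarrow> 'a^'l^'k" where
  "mat_unit a b x = (\<chi> p q. if p = a \<and> q = b then x else 0)"

lemma qcnj_simps [simp]:
  "qcnj 0 = 0" "qcnj 1 = 1" "qcnj (qcnj x) = x"
  by (simp_all add: qcnj_def zero_quat_def one_quat_def)

lemma qcnj_add: "qcnj (x + y) = qcnj x + qcnj y"
  by (simp add: qcnj_def plus_quat_def)

lemma qcnj_diff: "qcnj (x - y) = qcnj x - qcnj y"
  by (simp add: qcnj_def minus_quat_def)

lemma qcnj_mult: "qcnj (x * y) = qcnj y * qcnj x"
  by (simp add: qcnj_def times_quat_def algebra_simps)

lemma quat_units_swapped:
  "Quat 0 0 1 0 * Quat 0 1 0 0 = - Quat 0 0 0 1"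
  "Quat 0 0 0 1 * Quat 0 0 1 0 = - Quat 0 1 0 0"
  "Quat 0 1 0 0 * Quat 0 0 0 1 = - Quat 0 0 1 0"
  by (simp_all add: times_quat_def uminus_quat_def)

text \<open>Once products are nested to the right, two adjacent units occur with a further factor
  inside the second product, where the plain multiplication table no longer matches.\<close>

lemma quat_units_mult_left:
  "Quat 0 1 0 0 * (Quat 0 1 0 0 * x) = - x"
  "Quat 0 0 1 0 * (Quat 0 0 1 0 * x) = - x"
  "Quat 0 0 0 1 * (Quat 0 0 0 1 * x) = - x"
  "Quat 0 1 0 0 * (Quat 0 0 1 0 * x) = Quat 0 0 0 1 * x"
  "Quat 0 0 1 0 * (Quat 0 0 0 1 * x) = Quat 0 1 0 0 * x"
  "Quat 0 0 0 1 * (Quat 0 1 0 0 * x) = Quat 0 0 1 0 * x"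
  "Quat 0 0 1 0 * (Quat 0 1 0 0 * x) = - (Quat 0 0 0 1 * x)"
  "Quat 0 0 0 1 * (Quat 0 0 1 0 * x) = - (Quat 0 1 0 0 * x)"
  "Quat 0 1 0 0 * (Quat 0 0 0 1 * x) = - (Quat 0 0 1 0 * x)"
  by (simp_all add: quat_units quat_units_swapped flip: mult.assoc)

text \<open>For s = -1 the units enter \<open>witness\<close> in this form; pulling the sign out
  lets the multiplication table apply.\<close>

lemma quat_units_uminus:
  "Quat 0 (- 1) 0 0 = - Quat 0 1 0 0"
  "Quat 0 0 (- 1) 0 = - Quat 0 0 1 0"
  "Quat 0 0 0 (- 1) = - Quat 0 0 0 1"
  by (simp_all add: uminus_quat_def)

lemma qcnj_units:
  "qcnj (Quat 0 1 0 0) = - Quat 0 1 0 0"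
  "qcnj (Quat 0 0 1 0) = - Quat 0 0 1 0"
  "qcnj (Quat 0 0 0 1) = - Quat 0 0 0 1"
  by (simp_all add: qcnj_def uminus_quat_def)

lemma kronecker_add_left: "kronecker (A + B) C = kronecker A C + kronecker B C"
  by (simp add: kronecker_def vec_eq_iff distrib_right)

lemma kronecker_add_right: "kronecker A (B + C) = kronecker A B + kronecker A C"
  by (simp add: kronecker_def vec_eq_iff distrib_left)

lemma kronecker_mat_unit:
  "kronecker (mat_unit a b x) (mat_unit i j r) = mat_unit (a, i) (b, j) (r *\<^sub>R x)"
  by (auto simp: kronecker_def mat_unit_def vec_eq_iff prod_eq_iff of_real_def)

lemma partial_transpose_add:
  "partial_transpose (A + B) = partial_transpose A + partial_transpose B"
  by (simp add: partial_transpose_def vec_eq_iff)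

text \<open>Exchanging blocks swaps only the first components of the indices, so the first factor is
  transposed, without conjugation, and the second is untouched.\<close>

lemma partial_transpose_kronecker:
  "partial_transpose (kronecker A B) = kronecker (transpose A) B"
  by (simp add: partial_transpose_def kronecker_def transpose_def vec_eq_iff)

lemma transpose_add: "transpose (A + B) = transpose A + transpose B"
  by (simp add: transpose_def vec_eq_iff)

lemma transpose_mat_unit: "transpose (mat_unit a b x) = mat_unit b a x"
  by (auto simp: transpose_def mat_unit_def vec_eq_iff)

lemma qform_add: "qform (A + B) v = qform A v + qform B v"
  by (simp add: qform_def algebra_simps sum.distrib)

lemma qform_mat_unit: "qform (mat_unit p q x) v = qcnj (v $ p) * x * v $ q"
proof -
  \<comment> \<open>Testing j outermost lets the delta rule collapse the inner sum and then the
    outer one.\<close>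
  have "qform (mat_unit p q x) v
      = (\<Sum>i\<in>UNIV. \<Sum>j\<in>UNIV. if j = q then if i = p then qcnj (v $ p) * x * v $ q else 0 else 0)"
    unfolding qform_def by (intro sum.cong) (auto simp: mat_unit_def)
  then show ?thesis
    by simp
qed

lemma qcnj_mult_self_nonneg: "qcnj x * x \<in> \<real>\<^sub>\<ge>\<^sub>0"
proof -
  have "qcnj x * x = of_real ((qre x)\<^sup>2 + (qi x)\<^sup>2 + (qj x)\<^sup>2 + (qk x)\<^sup>2)"
    by (simp add: quat_eq_iff of_real_def qcnj_def times_quat_def scaleR_quat_def one_quat_def
        power2_eq_square)
  then show ?thesis
    by (simp only: nonneg_Reals_of_real_iff) simp
qed

lemma qre_nonneg_Reals: "x \<in> \<real>\<^sub>\<ge>\<^sub>0 \<Longrightarrow> qre x \<ge> 0"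
  by (auto elim!: nonneg_Reals_cases simp: of_real_def scaleR_quat_def one_quat_def)

definition herm_pair :: "'m \<Rightarrow> 'm \<Rightarrow> quat \<Rightarrow> quat^'m^'m" where
  "herm_pair a b x = mat_unit a b x + mat_unit b a (qcnj x)"

definition sym_pair :: "'n \<Rightarrow> 'n \<Rightarrow> real^'n^'n" where
  "sym_pair i j = mat_unit i j 1 + mat_unit j i 1"

(* s = 1 gives [[1, W], [W*, Y]] and s = -1 gives [[1, W*], [W, Y]]. *)
definition witness ::
  "real \<Rightarrow> 'm::finite \<Rightarrow> 'm \<Rightarrow> 'n::finite \<Rightarrow> 'n \<Rightarrow> 'n \<Rightarrow> quat^('m \<times> 'n)^('m \<times> 'n)" where
  "witness s a b i j k =
     kronecker (mat_unit a a 1) (mat_unit i i 1 + mat_unit j j 1 + mat_unit k k 1)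
   + kronecker (mat_unit b b 1) (mat_unit i i 6 + mat_unit j j 2 + mat_unit k k 6)
   + kronecker (herm_pair a b 1) (mat_unit i i 1 + mat_unit k k (- 1))
   + kronecker (herm_pair a b (Quat 0 s 0 0)) (sym_pair j k)
   + kronecker (herm_pair a b (Quat 0 0 s 0)) (sym_pair i k)
   + kronecker (herm_pair a b (Quat 0 0 0 s)) (sym_pair i j)"

lemma mat_unit_hermitian: "qcnj x = x \<Longrightarrow> mat_unit a a x \<in> quat_hermitian"
  by (auto simp: quat_hermitian_def qadjoint_def mat_unit_def vec_eq_iff)

lemma herm_pair_hermitian: "a \<noteq> b \<Longrightarrow> herm_pair a b x \<in> quat_hermitian"
  by (auto simp: quat_hermitian_def qadjoint_def herm_pair_def mat_unit_def vec_eq_iff)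

lemma mat_unit_symmetric: "mat_unit i i r \<in> real_symmetric"
  by (simp add: real_symmetric_def transpose_mat_unit)

lemma sym_pair_symmetric: "sym_pair i j \<in> real_symmetric"
  by (simp add: real_symmetric_def sym_pair_def transpose_add transpose_mat_unit add.commute)

lemma add_symmetric:
  "A \<in> real_symmetric \<Longrightarrow> B \<in> real_symmetric \<Longrightarrow> A + B \<in> real_symmetric"
  by (simp add: real_symmetric_def transpose_add)

lemma kronecker_in_tensor_QS:
  "A \<in> quat_hermitian \<Longrightarrow> B \<in> real_symmetric \<Longrightarrow> kronecker A B \<in> tensor_QS"
  unfolding tensor_QS_def by (rule span_base) blast

lemma add_in_tensor_QS: "A \<in> tensor_QS \<Longrightarrow> B \<in> tensor_QS \<Longrightarrow> A + B \<in> tensor_QS"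
  unfolding tensor_QS_def by (rule span_add)

lemma witness_in_tensor_QS: "a \<noteq> b \<Longrightarrow> witness s a b i j k \<in> tensor_QS"
  unfolding witness_def
  by (intro add_in_tensor_QS kronecker_in_tensor_QS mat_unit_hermitian herm_pair_hermitian
      add_symmetric mat_unit_symmetric sym_pair_symmetric) simp_all

text \<open>Turns \<open>witness\<close> into a sum of single-entry matrices, so that its form
  becomes a sum of monomials.\<close>

lemmas witness_expand = witness_def herm_pair_def sym_pair_def
  kronecker_add_left kronecker_add_right kronecker_mat_unit

lemma transpose_herm_pair: "transpose (herm_pair a b x) = herm_pair a b (qcnj x)"
  by (simp add: herm_pair_def transpose_add transpose_mat_unit add.commute)

text \<open>Transposing a \<open>herm_pair\<close> conjugates its coefficient: 1 is fixed and the
  imaginary units change sign, so W and W* trade places.\<close>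

lemma partial_transpose_witness:
  "partial_transpose (witness s a b i j k) = witness (- s) a b i j k"
proof -
  have "qcnj (Quat 0 s 0 0) = Quat 0 (- s) 0 0" "qcnj (Quat 0 0 s 0) = Quat 0 0 (- s) 0"
    "qcnj (Quat 0 0 0 s) = Quat 0 0 0 (- s)"
    by (simp_all add: qcnj_def)
  then show ?thesis
    by (simp only: witness_def partial_transpose_add partial_transpose_kronecker
        transpose_mat_unit transpose_herm_pair qcnj_simps)
qed

lemma qform_witness_minus_one:
  fixes v :: "quat^('m::finite \<times> 'n::finite)"
    and a b :: 'm and i j k :: 'n
  defines "t1 \<equiv> v $ (a, i) + v $ (b, i) - Quat 0 0 0 1 * v $ (b, j) - Quat 0 0 1 0 * v $ (b, k)"
    and "t2 \<equiv> v $ (a, j) - Quat 0 0 0 1 * v $ (b, i) - Quat 0 1 0 0 * v $ (b, k)"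
    and "t3 \<equiv> v $ (a, k) - Quat 0 0 1 0 * v $ (b, i) - Quat 0 1 0 0 * v $ (b, j) - v $ (b, k)"
    and "t4 \<equiv> v $ (b, i) + Quat 0 0 1 0 * v $ (b, k)"
  shows "qform (witness (- 1) a b i j k) v
    = qcnj t1 * t1 + qcnj t2 * t2 + qcnj t3 * t3
      + (qcnj t4 * t4 + qcnj t4 * t4 + qcnj t4 * t4)"
proof -
  have qcnj_uminus: "qcnj (- x) = - qcnj x" for x
    using qcnj_diff[of 0 x] by simp
  show ?thesis
    unfolding witness_expand qform_add qform_mat_unit t1_def t2_def t3_def t4_def
    \<comment> \<open>After expansion, the second call compares coordinates with the remaining
      products kept as atoms; this linear comparison reconciles the scalars 2 and 6 with repeated
      summands.\<close>
    by (simp add: qcnj_add qcnj_diff qcnj_mult qcnj_uminus qcnj_units quat_units_uminus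
        quat_units_mult_left distrib_left distrib_right left_diff_distrib right_diff_distrib
        mult.assoc,
      simp add: quat_eq_iff plus_quat_def scaleR_quat_def)
qed

lemma witness_psd:
  assumes "a \<noteq> b"
  shows "quat_psd (witness (- 1) a b i j k)"
proof -
  have "qform (witness (- 1) a b i j k) v \<in> \<real>\<^sub>\<ge>\<^sub>0" for v
    unfolding qform_witness_minus_one
    by (intro nonneg_Reals_add_I qcnj_mult_self_nonneg)
  then show ?thesis
    using subsetD[OF tensor_QS_hermitian witness_in_tensor_QS[OF assms]] by (simp add: quat_psd_def)
qed

lemma witness_not_psd:
  assumes "a \<noteq> b" "i \<noteq> j" "i \<noteq> k" "j \<noteq> k"
  shows "\<not> quat_psd (witness 1 a b i j k)"
proof
  assume psd: "quat_psd (witness 1 a b i j k)"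
  (* On v = (- W x, x) the form takes the value x* (Y - W* W) x; here x = (1, - k, 0). *)
  define v where "v = (\<chi> p.
    if p = (a, i) then Quat (- 2) 0 0 0 else
    if p = (a, j) then Quat 0 0 0 (- 1) else
    if p = (a, k) then Quat 0 0 (- 2) 0 else
    if p = (b, i) then 1 else
    if p = (b, j) then Quat 0 0 0 (- 1) else 0)"
  have v: "v $ (a, i) = Quat (- 2) 0 0 0" "v $ (a, j) = Quat 0 0 0 (- 1)"
    "v $ (a, k) = Quat 0 0 (- 2) 0" "v $ (b, i) = Quat 1 0 0 0"
    "v $ (b, j) = Quat 0 0 0 (- 1)" "v $ (b, k) = Quat 0 0 0 0"
    using assms by (auto simp: v_def one_quat_def zero_quat_def)
  \<comment> \<open>In the first two coordinates Y - W* W is [[3, -2k], [2k, 0]], with k the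
    quaternion unit; at (1, -k) this gives 3 - 2 - 2.\<close>
  have "qre (qform (witness 1 a b i j k) v) = - 1"
    unfolding witness_expand qform_add qform_mat_unit v
    by (simp add: qcnj_def times_quat_def plus_quat_def uminus_quat_def
        one_quat_def of_real_def scaleR_quat_def)
  moreover have "qre (qform (witness 1 a b i j k) v) \<ge> 0"
    using psd by (intro qre_nonneg_Reals) (simp add: quat_psd_def)
  ultimately show False
    by simp
qed

theorem corollary5p6:
  assumes "CARD('m::finite) \<ge> 2" and "CARD('n::finite) \<ge> 3"
  shows "{A \<in> (tensor_QS :: (quat^('m \<times> 'n)^('m \<times> 'n)) set). quat_ppt A}
       \<subset> {A \<in> (tensor_QS :: (quat^('m \<times> 'n)^('m \<times> 'n)) set). quat_psd A}"
proof -
  \<comment> \<open>Two block indices and three positions carry the 6 by 6 example; all other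
    entries of \<open>witness\<close> are zero.\<close>
  obtain S :: "'m set" where "card S = 2"
    using obtain_subset_with_card_n[OF assms(1)] by blast
  then obtain a b :: 'm where ab: "a \<noteq> b"
    unfolding card_2_iff by blast
  obtain T :: "'n set" where "card T = 3"
    using obtain_subset_with_card_n[OF assms(2)] by blast
  then obtain i j k :: 'n where ijk: "i \<noteq> j" "i \<noteq> k" "j \<noteq> k"
    unfolding card_3_iff by blast
  have "\<not> quat_ppt (witness (- 1) a b i j k)"
    using witness_not_psd[OF ab ijk] by (simp add: quat_ppt_def partial_transpose_witness)
  moreover have "witness (- 1) a b i j k \<in> tensor_QS" "quat_psd (witness (- 1) a b i j k)"
    by (rule witness_in_tensor_QS[OF ab] witness_psd[OF ab])+
  ultimately show ?thesis
    unfolding quat_ppt_def by blast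
qed

end
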